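(* Let $\mathcal{H}$ be a real separable Hilbert space, $\mathcal{X}\subseteq\mathcal{H}$ a nonempty closed convex set, and $F:\mathcal{H}\to\mathcal{H}$ a map such that: (i) $F$ is Lipschitz continuous with constant $L>0$ and sequentially weak-to-weak continuous on bounded subsets of $\mathcal{H}$; (ii) $F$ is pseudo-monotone on $\mathcal{X}$; (iii) the solution set $\mathcal{X}_{\ast}$ of $\mathrm{VI}(\mathcal{X},F)$ is nonempty, closed and convex. Let $\gamma\in(0,1/L)$. Let $(\alpha_k)_{k\ge 0}$ and $(\beta_k)_{k\ge 0}$ be real sequences in $(0,1)$ such that, for some $\alpha>0$, $\beta_k\in(\alpha,1-\alpha_k)$ for all $k\ge 0$, and $$\lim_{k\to\infty}\alpha_k=0,\qquad \sum_{k=1}^{\infty}\alpha_k=\infty.$$ Let $x^0\in\mathcal{X}$ and let $(x^k)_{k\ge 0}$ be defined, for $k\ge 0$, by $$z^k=P_{\mathcal{X}}[x^k-\gamma F(x^k)],\qquad r^k=z^k+\gamma\,(F(x^k)-F(z^k)),\qquad x^{k+1}=(1-\alpha_k-\beta_k)x^k+\beta_k r^k.$$ Then $(x^k)_{k\ge 0}$ converges strongly (i.e. in norm) to $p\in\mathcal{X}_{\ast}$, where $p=\operatorname{argmin}\{\|z\|: z\in\mathcal{X}_{\ast}\}$.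
   Context: $\langle\cdot,\cdot\rangle$ and $\|\cdot\|$ are the inner product and induced norm of $\mathcal{H}$. $P_{\mathcal{X}}$ is the metric projection onto $\mathcal{X}$: $P_{\mathcal{X}}(x)=\operatorname{argmin}_{y\in\mathcal{X}}\frac12\|y-x\|^2$. $F$ is pseudo-monotone on $\mathcal{X}$ if for all $x,y\in\mathcal{X}$: $\langle F(x),y-x\rangle\ge 0 \Rightarrow \langle F(y),y-x\rangle\ge 0$. $F$ is sequentially weak-to-weak continuous on bounded subsets if for every (bounded) weakly convergent sequence $x_n\rightharpoonup x$ one has $F(x_n)\rightharpoonup F(x)$. $\mathrm{VI}(\mathcal{X},F)$ is the problem of finding $x^{\ast}\in\mathcal{X}$ such that $\langle F(x^{\ast}),x-x^{\ast}\rangle\ge 0$ for all $x\in\mathcal{X}$; $\mathcal{X}_{\ast}\subset\mathcal{X}$ is its set of solutions. *)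

theory Defs
  imports "HOL-Analysis.Analysis"
begin

(* closest_point is not used here: the library restricts it to Heine-Borel
   (finite-dimensional) spaces. *)
definition metric_proj :: "'a::real_inner set \<Rightarrow> 'a \<Rightarrow> 'a" where
  "metric_proj X x = arg_min_on (\<lambda>y. 1/2 * (norm (y - x))\<^sup>2) X"

(* Weak convergence in a Hilbert space: by Riesz representation, the continuous
   linear functionals are exactly the maps u \<mapsto> u \<bullet> y. *)
definition weakly_tendsto :: "(nat \<Rightarrow> 'a::real_inner) \<Rightarrow> 'a \<Rightarrow> bool" where
  "weakly_tendsto u l \<longleftrightarrow> (\<forall>y. (\<lambda>n. u n \<bullet> y) \<longlonglongrightarrow> l \<bullet> y)"

definition seq_weak_weak_continuous_on_bounded :: "('a::real_inner \<Rightarrow> 'a) \<Rightarrow> bool" where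
  "seq_weak_weak_continuous_on_bounded F \<longleftrightarrow>
     (\<forall>u l. bounded (range u) \<longrightarrow> weakly_tendsto u l \<longrightarrow> weakly_tendsto (\<lambda>n. F (u n)) (F l))"

definition pseudo_monotone_on :: "'a::real_inner set \<Rightarrow> ('a \<Rightarrow> 'a) \<Rightarrow> bool" where
  "pseudo_monotone_on X F \<longleftrightarrow>
     (\<forall>x\<in>X. \<forall>y\<in>X. F x \<bullet> (y - x) \<ge> 0 \<longrightarrow> F y \<bullet> (y - x) \<ge> 0)"

definition VI_solutions :: "'a::real_inner set \<Rightarrow> ('a \<Rightarrow> 'a) \<Rightarrow> 'a set" where
  "VI_solutions X F = {s \<in> X. \<forall>x\<in>X. F s \<bullet> (x - s) \<ge> 0}"

end

theory Submission
  imports Defs "HOL-Complex_Analysis.Great_Picard"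
begin

text \<open>
  A forward-backward-forward step satisfies \<open>\<parallel>r\<^sub>k - p\<parallel>\<^sup>2 \<le> \<parallel>x\<^sub>k - p\<parallel>\<^sup>2 - (1 - \<gamma>\<^sup>2L\<^sup>2) \<parallel>x\<^sub>k - z\<^sub>k\<parallel>\<^sup>2\<close> for every
  solution \<open>p\<close>, so the iterates are bounded. For the solution \<open>p\<close> of minimal norm, \<open>a\<^sub>k = \<parallel>x\<^sub>k - p\<parallel>\<^sup>2\<close> and
  \<open>d\<^sub>k = \<parallel>x\<^sub>k - z\<^sub>k\<parallel>\<close>, the anchoring towards \<open>0\<close> gives a bounded \<open>b\<^sub>k\<close> and a constant \<open>c > 0\<close> with
  \<open>a\<^sub>k\<^sub>+\<^sub>1 \<le> (1 - \<alpha>\<^sub>k) a\<^sub>k + \<alpha>\<^sub>k (b\<^sub>k - c d\<^sub>k\<^sup>2 / \<alpha>\<^sub>k)\<close>. The bracket has nonpositive limes superior: on a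
  subsequence where it exceeds some \<open>e > 0\<close> we have \<open>d\<^sub>k \<rightarrow> 0\<close>, every weak cluster point \<open>q\<close> is a
  solution, and \<open>b\<^sub>k\<close> tends to \<open>- 2 \<langle>p, q - p\<rangle> \<le> 0\<close>. As \<open>\<Sum>\<alpha>\<^sub>k = \<infinity>\<close>, this forces \<open>a\<^sub>k \<rightarrow> 0\<close>.
\<close>

section \<open>Minimizers of quadratic functionals in a Hilbert space\<close>

text \<open>The metric projection onto \<open>S\<close>, the Riesz representation (\<open>S = UNIV\<close>) and the point of minimal norm
  (\<open>l = 0\<close>) are all minimizers of \<open>\<parallel>u\<parallel>\<^sup>2/2 - l u\<close>.\<close>

lemma quadratic_minimizer:
  fixes S :: "'a::{real_inner, complete_space} set"
  assumes S: "S \<noteq> {}" "closed S" "convex S" and l: "bounded_linear l"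
  shows "\<exists>u\<in>S. \<forall>y\<in>S. l (y - u) \<le> u \<bullet> (y - u)"
proof -
  interpret l: bounded_linear l by (rule l)
  define f where "f u = (norm u)\<^sup>2 / 2 - l u" for u
  obtain K where K: "\<And>u. norm (l u) \<le> norm u * K"
    using l.bounded by blast
  have f_lower: "- (K\<^sup>2 / 2) \<le> f u" for u
  proof -
    have "0 \<le> (norm u - K)\<^sup>2" by simp
    moreover have "l u \<le> norm u * K" using K[of u] by simp
    ultimately show ?thesis unfolding f_def by (simp add: power2_eq_square algebra_simps)
  qed
  define I where "I = (INF u\<in>S. f u)"
  have bdd: "bdd_below (f ` S)" using f_lower by (intro bdd_belowI2)
  have I_le: "I \<le> f u" if "u \<in> S" for u
    unfolding I_def using bdd that by (rule cINF_lower)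
  have "\<exists>u\<in>S. f u < I + 1 / real (Suc n)" for n
  proof -
    have "Inf (f ` S) < I + 1 / real (Suc n)" by (simp add: I_def)
    then show ?thesis using S(1) bdd by (subst (asm) cInf_less_iff) auto
  qed
  then obtain u where uS: "\<And>n. u n \<in> S" and fu: "\<And>n. f (u n) < I + 1 / real (Suc n)"
    by metis
  \<comment> \<open>The linear part cancels at the midpoint, so the parallelogram law carries over
    to \<open>f\<close>. Midpoints stay in \<open>S\<close>, where \<open>f\<close> is at least
    \<open>I\<close>, so the minimizing sequence \<open>u\<close> is Cauchy and completeness
    supplies the limit.\<close>
  have parallelogram: "(norm (v - w))\<^sup>2 / 4 = f v + f w - 2 * f ((1/2) *\<^sub>R (v + w))" for v w
    unfolding f_def l.scaleR l.add power2_norm_eq_inner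
    by (simp add: inner_simps inner_commute field_simps)
  have close: "(norm (u m - u n))\<^sup>2 \<le> 4 / real (Suc m) + 4 / real (Suc n)" for m n
  proof -
    have "(1/2) *\<^sub>R (u m + u n) \<in> S"
      using convexD[OF S(3) uS[of m] uS[of n], of "1/2" "1/2"] by (simp add: scaleR_add_right)
    from I_le[OF this] show ?thesis
      using parallelogram[of "u m" "u n"] fu[of m] fu[of n] by linarith
  qed
  have "Cauchy u"
  proof (rule metric_CauchyI)
    fix e :: real assume "e > 0"
    obtain N where N: "8 / e\<^sup>2 < real N" using reals_Archimedean2 by blast
    have "dist (u m) (u n) < e" if "m \<ge> N" "n \<ge> N" for m n
    proof -
      have *: "4 / real (Suc k) < e\<^sup>2 / 2" if "k \<ge> N" for k
      proof -
        have "8 / e\<^sup>2 < real (Suc k)" using N that by linarith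
        then show ?thesis using \<open>e > 0\<close> by (simp add: field_simps)
      qed
      have "(norm (u m - u n))\<^sup>2 < e\<^sup>2"
        using close[of m n] *[OF that(1)] *[OF that(2)] by linarith
      then show ?thesis using \<open>e > 0\<close> by (simp add: dist_norm power2_less_imp_less)
    qed
    then show "\<exists>N. \<forall>m\<ge>N. \<forall>n\<ge>N. dist (u m) (u n) < e" by blast
  qed
  then obtain v where v: "u \<longlonglongrightarrow> v" using Cauchy_convergent convergentD by blast
  have vS: "v \<in> S" using closed_sequentially[OF S(2)] uS v by blast
  have "(\<lambda>n. f (u n)) \<longlonglongrightarrow> f v"
    unfolding f_def by (intro tendsto_intros l.tendsto v) simp
  moreover have "(\<lambda>n. I + 1 / real (Suc n)) \<longlonglongrightarrow> I + 0"
    by (intro tendsto_intros LIMSEQ_Suc[OF lim_const_over_n])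
  ultimately have "f v \<le> I + 0"
    by (rule LIMSEQ_le) (use fu less_imp_le in blast)
  then have fv: "f v \<le> f y" if "y \<in> S" for y using I_le[OF that] by simp
  have "l (y - v) \<le> v \<bullet> (y - v)" if y: "y \<in> S" for y
  proof -
    let ?h = "y - v"
    \<comment> \<open>First-order condition from one side: \<open>v\<close> is compared with a point
      of the segment towards \<open>y\<close>, the factor \<open>t\<close> is divided out, and then
      \<open>t\<close> tends to 0 from the right.\<close>
    have *: "l ?h - v \<bullet> ?h \<le> t * (norm ?h)\<^sup>2 / 2" if t: "0 < t" "t < 1" for t
    proof -
      have "v + t *\<^sub>R ?h \<in> S"
        using convexD_alt[OF S(3) vS y, of t] t by (simp add: algebra_simps)
      from fv[OF this] have "t * (l ?h - v \<bullet> ?h) \<le> t * (t * (norm ?h)\<^sup>2 / 2)"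
        unfolding f_def l.add l.scaleR power2_norm_eq_inner inner_add_left inner_add_right
        by (simp add: inner_commute[of y v] algebra_simps)
      then show ?thesis using t by simp
    qed
    have "((\<lambda>t. t * (norm ?h)\<^sup>2 / 2) \<longlongrightarrow> 0 * (norm ?h)\<^sup>2 / 2) (at_right 0)"
      by (intro tendsto_intros) simp
    moreover have "\<forall>\<^sub>F t in at_right 0. l ?h - v \<bullet> ?h \<le> t * (norm ?h)\<^sup>2 / 2"
      using eventually_at_right_less[of 0] eventually_at_right_real[OF zero_less_one]
      by eventually_elim (use * in auto)
    ultimately have "l ?h - v \<bullet> ?h \<le> 0 * (norm ?h)\<^sup>2 / 2"
      by (intro tendsto_lowerbound[where F = "at_right 0"]) auto
    then show ?thesis by simp
  qed
  with vS show ?thesis by blast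
qed

lemma Riesz_representation:
  fixes l :: "'a::{real_inner, complete_space} \<Rightarrow> real"
  assumes "bounded_linear l"
  shows "\<exists>u. \<forall>y. l y = u \<bullet> y"
proof -
  interpret l: bounded_linear l by (rule assms)
  obtain u where u: "\<And>y. l (y - u) \<le> u \<bullet> (y - u)"
    using quadratic_minimizer[of UNIV l] assms by auto
  \<comment> \<open>On the whole space both directions \<open>y\<close> and \<open>- y\<close> are
    admissible, which turns the inequality into an equality.\<close>
  have "l y = u \<bullet> y" for y
    using u[of "u + y"] u[of "u - y"] by (simp add: l.neg)
  then show ?thesis by blast
qed

text \<open>\<open>metric_proj\<close> chooses some minimizer. The variational inequality is known
  for one particular \<open>u\<close>; expanding the square around \<open>u\<close> shows that
  \<open>u\<close> is a minimizer and the only one, hence the chosen point.\<close>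

lemma metric_proj_in_and_variational:
  fixes S :: "'a::{real_inner, complete_space} set"
  assumes S: "S \<noteq> {}" "closed S" "convex S"
  shows "metric_proj S x \<in> S \<and> (\<forall>y\<in>S. (x - metric_proj S x) \<bullet> (y - metric_proj S x) \<le> 0)"
proof -
  obtain u where uS: "u \<in> S" and u: "\<And>y. y \<in> S \<Longrightarrow> x \<bullet> (y - u) \<le> u \<bullet> (y - u)"
    using quadratic_minimizer[OF S bounded_linear_inner_right[of x]] by blast
  have expand: "(norm (y - x))\<^sup>2 = (norm (u - x))\<^sup>2 + (norm (y - u))\<^sup>2 + 2 * ((u - x) \<bullet> (y - u))" for y
    unfolding power2_norm_eq_inner by (simp add: inner_simps inner_commute)
  let ?f = "\<lambda>y. 1/2 * (norm (y - x))\<^sup>2"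
  have "(norm (u - x))\<^sup>2 \<le> (norm (y - x))\<^sup>2" if "y \<in> S" for y
    using expand[of y] u[OF that] by (simp add: inner_diff_left)
  then have "is_arg_min ?f (\<lambda>y. y \<in> S) u"
    using uS by (auto simp: is_arg_min_linorder)
  then have "is_arg_min ?f (\<lambda>y. y \<in> S) (metric_proj S x)"
    unfolding metric_proj_def arg_min_on_def arg_min_def by (rule someI)
  then have "metric_proj S x \<in> S" "(norm (metric_proj S x - x))\<^sup>2 \<le> (norm (u - x))\<^sup>2"
    using uS by (auto simp: is_arg_min_linorder)
  with expand[of "metric_proj S x"] u[of "metric_proj S x"]
  have "(norm (metric_proj S x - u))\<^sup>2 \<le> 0" unfolding inner_diff_left by argo
  then have "metric_proj S x = u" by simp
  then show ?thesis using uS u by (simp add: inner_diff_left)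
qed

text \<open>The inequality at \<open>p\<close> is what the convergence proof exploits; the singleton
  expresses that the argmin of the norm is unique. Both minimality and uniqueness follow by
  expanding around \<open>p\<close>.\<close>

lemma min_norm_point:
  fixes S :: "'a::{real_inner, complete_space} set"
  assumes S: "S \<noteq> {}" "closed S" "convex S"
  obtains p where "p \<in> S" "\<And>s. s \<in> S \<Longrightarrow> 0 \<le> p \<bullet> (s - p)"
    "{q. is_arg_min norm (\<lambda>s. s \<in> S) q} = {p}"
proof -
  obtain p where p: "p \<in> S" "\<And>s. s \<in> S \<Longrightarrow> 0 \<le> p \<bullet> (s - p)"
    using quadratic_minimizer[OF S bounded_linear_zero] by blast
  have expand: "(norm s)\<^sup>2 = (norm p)\<^sup>2 + (norm (s - p))\<^sup>2 + 2 * (p \<bullet> (s - p))" for s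
    unfolding power2_norm_eq_inner by (simp add: inner_simps inner_commute)
  have "(norm p)\<^sup>2 \<le> (norm s)\<^sup>2" if "s \<in> S" for s
    using expand[of s] p(2)[OF that] by simp
  then have "norm p \<le> norm s" if "s \<in> S" for s using that power2_le_imp_le norm_ge_zero by blast
  moreover have "s = p" if "s \<in> S" "norm s \<le> norm p" for s
  proof -
    have "(norm s)\<^sup>2 \<le> (norm p)\<^sup>2" using that(2) by (simp add: power_mono)
    then have "(norm (s - p))\<^sup>2 \<le> 0" using expand[of s] p(2)[OF that(1)] by linarith
    then show ?thesis by simp
  qed
  ultimately have "{q. is_arg_min norm (\<lambda>s. s \<in> S) q} = {p}"
    using p(1) by (auto simp: is_arg_min_linorder)
  with p that show ?thesis by blast
qed

section \<open>Weak convergence\<close>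

text \<open>Separability gives a countable dense set on which a diagonal argument makes all inner
  products converge. The norm bound extends this to every \<open>y\<close>, and Riesz turns the
  bounded linear limit functional into the weak limit.\<close>

lemma bounded_imp_weakly_convergent_subseq:
  fixes u :: "nat \<Rightarrow> 'a::{real_inner, complete_space}"
  assumes sep: "separable_space (euclidean :: 'a topology)" and bdd: "\<And>n. norm (u n) \<le> M"
  obtains k q where "strict_mono (k :: nat \<Rightarrow> nat)" "weakly_tendsto (u \<circ> k) q"
proof -
  obtain D :: "'a set" where D: "countable D" "closure D = UNIV"
    using sep by (auto simp: separable_space_def)
  have M: "0 \<le> M" using bdd[of 0] norm_ge_zero order_trans by blast
  \<comment> \<open>The diagonal selection asks for one bound valid for all \<open>d\<close>, so
    each \<open>d\<close> is normalised by \<open>sgn\<close>; \<open>convD\<close> multiplies by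
    \<open>norm d\<close> again.\<close>
  have "norm (u n \<bullet> sgn d) \<le> M" for n d
  proof -
    have "\<bar>u n \<bullet> sgn d\<bar> \<le> norm (u n) * norm (sgn d)" by (rule Cauchy_Schwarz_ineq2)
    also have "\<dots> \<le> norm (u n) * 1" by (intro mult_left_mono) (auto simp: norm_sgn)
    finally show ?thesis using bdd[of n] by simp
  qed
  then obtain k where k: "strict_mono (k :: nat \<Rightarrow> nat)"
    and lim: "\<And>d. d \<in> D \<Longrightarrow> \<exists>l. (\<lambda>n. u (k n) \<bullet> sgn d) \<longlonglongrightarrow> l"
    using function_convergent_subsequence[OF D(1), of "\<lambda>n d. u n \<bullet> sgn d" M] by metis
  have convD: "Cauchy (\<lambda>n. u (k n) \<bullet> d)" if d: "d \<in> D" for d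
  proof -
    obtain l where "(\<lambda>n. u (k n) \<bullet> sgn d) \<longlonglongrightarrow> l" using lim[OF d] by blast
    then have "(\<lambda>n. norm d * (u (k n) \<bullet> sgn d)) \<longlonglongrightarrow> norm d * l" by (rule tendsto_mult_left)
    moreover have "norm d * (u (k n) \<bullet> sgn d) = u (k n) \<bullet> d" for n
      by (cases "d = 0") (auto simp: sgn_div_norm)
    ultimately show ?thesis by (auto intro: LIMSEQ_imp_Cauchy)
  qed
  have bound: "\<bar>u n \<bullet> y\<bar> \<le> M * norm y" for n y
    using Cauchy_Schwarz_ineq2[of "u n" y] mult_right_mono[OF bdd[of n] norm_ge_zero[of y]] by simp
  have "Cauchy (\<lambda>n. u (k n) \<bullet> y)" for y
  proof (rule metric_CauchyI)
    fix e :: real assume e: "e > 0"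
    \<comment> \<open>The factor 3 splits \<open>e\<close> into three parts; \<open>M + 1\<close>
      replaces \<open>M\<close> because \<open>M\<close> may be 0.\<close>
    then have "0 < e / (3 * (M + 1))" using M by simp
    then obtain d where d: "d \<in> D" "dist d y < e / (3 * (M + 1))"
      using D(2) closure_approachable[of y D] by auto
    have near: "\<bar>u n \<bullet> y - u n \<bullet> d\<bar> < e / 3" for n
    proof -
      have "\<bar>u n \<bullet> (y - d)\<bar> \<le> M * norm (y - d)" by (rule bound)
      also have "\<dots> \<le> (M + 1) * norm (y - d)" by (intro mult_right_mono) auto
      also have "\<dots> < e / 3"
        using d(2) M by (simp add: dist_norm norm_minus_commute field_simps)
      finally show ?thesis by (simp add: inner_diff_right)
    qed
    obtain N where N: "\<And>m n. m \<ge> N \<Longrightarrow> n \<ge> N \<Longrightarrow> \<bar>u (k m) \<bullet> d - u (k n) \<bullet> d\<bar> < e / 3"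
      using metric_CauchyD[OF convD[OF d(1)], of "e / 3"] e by (auto simp: dist_real_def)
    have "dist (u (k m) \<bullet> y) (u (k n) \<bullet> y) < e" if "m \<ge> N" "n \<ge> N" for m n
      using N[OF that] near[of "k m"] near[of "k n"] unfolding dist_real_def by linarith
    then show "\<exists>N. \<forall>m\<ge>N. \<forall>n\<ge>N. dist (u (k m) \<bullet> y) (u (k n) \<bullet> y) < e" by blast
  qed
  then have "\<exists>l. (\<lambda>n. u (k n) \<bullet> y) \<longlonglongrightarrow> l" for y
    using Cauchy_convergent convergentD by blast
  then obtain l where l: "\<And>y. (\<lambda>n. u (k n) \<bullet> y) \<longlonglongrightarrow> l y" by metis
  have "bounded_linear l"
  proof (rule bounded_linear_intro[where K = M])
    show "l (x + y) = l x + l y" for x y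
      using tendsto_add[OF l[of x] l[of y]] LIMSEQ_unique[OF l[of "x + y"]]
      by (simp add: inner_add_right)
    show "l (c *\<^sub>R x) = c *\<^sub>R l x" for c x
      using tendsto_mult_left[OF l[of x], of c] LIMSEQ_unique[OF l[of "c *\<^sub>R x"]] by simp
    show "norm (l x) \<le> norm x * M" for x
      using tendsto_norm[OF l[of x]]
      by (rule LIMSEQ_le_const2) (use bound in \<open>auto simp: mult.commute\<close>)
  qed
  then obtain q where "\<And>y. l y = q \<bullet> y" using Riesz_representation by blast
  with l have "weakly_tendsto (u \<circ> k) q" by (simp add: weakly_tendsto_def)
  with k that show ?thesis by blast
qed

text \<open>The half-space that the projection of \<open>q\<close> provides contains
  \<open>S\<close> and is preserved by weak limits. Hence it contains \<open>q\<close> too, which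
  forces \<open>q\<close> to equal its projection.\<close>

lemma weakly_tendsto_closed_convex:
  fixes S :: "'a::{real_inner, complete_space} set"
  assumes S: "closed S" "convex S" and u: "\<And>n. u n \<in> S" and lim: "weakly_tendsto u q"
  shows "q \<in> S"
proof -
  have "S \<noteq> {}" using u by blast
  note proj = metric_proj_in_and_variational[OF this S, of q]
  let ?P = "metric_proj S q"
  have "u n \<bullet> (q - ?P) \<le> ?P \<bullet> (q - ?P)" for n
    using proj u[of n] by (force simp: inner_diff_left inner_diff_right inner_commute)
  moreover have "(\<lambda>n. u n \<bullet> (q - ?P)) \<longlonglongrightarrow> q \<bullet> (q - ?P)"
    using lim by (simp add: weakly_tendsto_def)
  ultimately have "q \<bullet> (q - ?P) \<le> ?P \<bullet> (q - ?P)"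
    by (intro LIMSEQ_le_const2) auto
  then have "(q - ?P) \<bullet> (q - ?P) \<le> 0" by (simp add: inner_diff_left)
  then have "q = ?P" by (simp add: inner_gt_zero_iff flip: not_less)
  then show ?thesis using proj by simp
qed

lemma weakly_tendsto_add_null:
  assumes u: "weakly_tendsto u q" and "(\<lambda>n. v n - u n) \<longlonglongrightarrow> 0"
  shows "weakly_tendsto v q"
  unfolding weakly_tendsto_def
proof
  fix y
  have "(\<lambda>n. u n \<bullet> y) \<longlonglongrightarrow> q \<bullet> y" using u by (simp add: weakly_tendsto_def)
  from tendsto_add[OF this tendsto_inner[OF assms(2) tendsto_const[of y]]]
  have "(\<lambda>n. u n \<bullet> y + (v n - u n) \<bullet> y) \<longlonglongrightarrow> q \<bullet> y + 0 \<bullet> y" .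
  then show "(\<lambda>n. v n \<bullet> y) \<longlonglongrightarrow> q \<bullet> y" by (simp add: inner_diff_left)
qed

section \<open>A recursive inequality for real sequences\<close>

text \<open>Once \<open>B\<close> is below \<open>e / 2\<close>, the excess of \<open>a\<close> over
  \<open>e / 2\<close> shrinks by factors \<open>1 - \<alpha> k\<close>, at most
  \<open>exp (- \<alpha> k)\<close>, whose product tends to 0 because the sum diverges.
  \<open>B\<close> is controlled from above only: in the application it contains a negative term
  over \<open>\<alpha> k\<close>.\<close>

lemma recursive_inequality_tendsto_zero:
  fixes a \<alpha> B :: "nat \<Rightarrow> real"
  assumes \<alpha>: "\<And>k. 0 \<le> \<alpha> k" "\<And>k. \<alpha> k \<le> 1"
    and div: "filterlim (\<lambda>n. \<Sum>k=1..n. \<alpha> k) at_top sequentially"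
    and a: "\<And>k. 0 \<le> a k"
    and rec: "\<And>k. a (Suc k) \<le> (1 - \<alpha> k) * a k + \<alpha> k * B k"
    and B: "\<And>e. e > 0 \<Longrightarrow> \<forall>\<^sub>F k in sequentially. B k \<le> e"
  shows "a \<longlonglongrightarrow> 0"
proof (rule LIMSEQ_I)
  fix e :: real assume e: "e > 0"
  obtain N where N: "\<And>k. k \<ge> N \<Longrightarrow> B k \<le> e / 2"
    using B[of "e / 2"] e by (auto simp: eventually_sequentially)
  let ?s = "\<lambda>n. \<Sum>k=1..n. \<alpha> k"
  let ?C = "\<lambda>n. exp (?s N - ?s n) * a (Suc N)"
  \<comment> \<open>Starting from \<open>a (Suc N)\<close>, exactly the factors with indices
    \<open>Suc N\<close> to \<open>n\<close> have been applied on reaching \<open>a (Suc n)\<close>.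
    This matches the difference of the partial sums, which begin at 1.\<close>
  have decay: "a (Suc n) \<le> e / 2 + ?C n" if "n \<ge> N" for n
    using that
  proof (induction n rule: dec_induct)
    case base
    then show ?case using e by simp
  next
    case (step n)
    have "1 - \<alpha> (Suc n) \<le> exp (- \<alpha> (Suc n))" using exp_ge_add_one_self[of "- \<alpha> (Suc n)"] by simp
    then have *: "(1 - \<alpha> (Suc n)) * ?C n \<le> exp (- \<alpha> (Suc n)) * ?C n"
      by (rule mult_right_mono) (simp add: a)
    have "a (Suc (Suc n)) \<le> (1 - \<alpha> (Suc n)) * a (Suc n) + \<alpha> (Suc n) * B (Suc n)" by (rule rec)
    also have "\<dots> \<le> (1 - \<alpha> (Suc n)) * (e / 2 + ?C n) + \<alpha> (Suc n) * (e / 2)"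
      by (intro add_mono mult_left_mono step.IH N) (use \<alpha> step.hyps in auto)
    also have "\<dots> = e / 2 + (1 - \<alpha> (Suc n)) * ?C n" by argo
    also have "\<dots> \<le> e / 2 + exp (- \<alpha> (Suc n)) * ?C n" using * by simp
    also have "exp (- \<alpha> (Suc n)) * ?C n = ?C (Suc n)"
      by (simp add: algebra_simps flip: exp_add)
    finally show ?case .
  qed
  have "filterlim (\<lambda>n. - ?s n) at_bot sequentially"
    using div by (simp add: filterlim_uminus_at_top)
  then have "(\<lambda>n. exp (- ?s n)) \<longlonglongrightarrow> 0" by (rule filterlim_compose[OF exp_at_bot])
  then have "(\<lambda>n. exp (?s N) * exp (- ?s n) * a (Suc N)) \<longlonglongrightarrow> exp (?s N) * 0 * a (Suc N)"
    by (intro tendsto_intros)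
  then have "?C \<longlonglongrightarrow> 0" by (simp add: exp_diff exp_minus field_simps)
  then have "\<forall>\<^sub>F n in sequentially. ?C n < e / 2" by (rule order_tendstoD) (use e in simp)
  then obtain N' where N': "\<And>n. n \<ge> N' \<Longrightarrow> ?C n < e / 2" by (auto simp: eventually_sequentially)
  have "norm (a n - 0) < e" if n: "n \<ge> Suc (max N N')" for n
  proof -
    obtain m where "n = Suc m" "m \<ge> N" "m \<ge> N'" using n by (cases n) auto
    then show ?thesis using decay[of m] N'[of m] a[of n] by simp
  qed
  then show "\<exists>N. \<forall>n\<ge>N. norm (a n - 0) < e" by blast
qed

section \<open>Weak limits of approximate solutions\<close>

text \<open>Pseudo-monotonicity is only available on \<open>X\<close>, so an approximate inequality at \<open>y\<close> can only be
  upgraded to an exact one by moving \<open>y\<close> inside \<open>X\<close>. If \<open>q\<close> violates the inequality at \<open>y\<close>, then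
  moving \<open>y\<close> towards \<open>q\<close> itself does this.\<close>

lemma weak_limit_in_VI_solutions:
  fixes X :: "'a::{real_inner, complete_space} set"
  assumes X: "closed X" "convex X"
    and F: "seq_weak_weak_continuous_on_bounded F" "continuous_on UNIV F" "pseudo_monotone_on X F"
    and z: "\<And>n. z n \<in> X" "bounded (range z)" "weakly_tendsto z q"
    and approx: "\<And>y e. \<lbrakk>y \<in> X; e > 0\<rbrakk> \<Longrightarrow> \<forall>\<^sub>F n in sequentially. - e \<le> F (z n) \<bullet> (y - z n)"
  shows "q \<in> VI_solutions X F"
proof -
  have q: "q \<in> X" by (rule weakly_tendsto_closed_convex[OF X z(1) z(3)])
  have Fz: "weakly_tendsto (\<lambda>n. F (z n)) (F q)"
    using F(1) z by (auto simp: seq_weak_weak_continuous_on_bounded_def)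
  have "0 \<le> F q \<bullet> (y - q)" if y: "y \<in> X" for y
  proof (rule ccontr)
    assume "\<not> 0 \<le> F q \<bullet> (y - q)"
    then have pos: "0 < F q \<bullet> (q - y)" by (simp add: inner_diff_right)
    let ?y = "\<lambda>t. q + t *\<^sub>R (y - q)"
    have minty: "0 \<le> F (?y t) \<bullet> (y - q)" if t: "0 < t" "t < 1" for t
    proof -
      have yt: "?y t \<in> X" using convexD_alt[OF X(2) q y, of t] t by (simp add: algebra_simps)
      \<comment> \<open>Moving from \<open>y\<close> to \<open>?y t\<close> adds a term with limit
        \<open>(1 - t) * (F q \<bullet> (q - y)) > 0\<close>. Half of that limit absorbs the
        approximation error.\<close>
      let ?e = "(1 - t) * (F q \<bullet> (q - y)) / 2"
      have e: "0 < ?e" using pos t by simp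
      have "(\<lambda>n. (1 - t) * (F (z n) \<bullet> (q - y))) \<longlonglongrightarrow> (1 - t) * (F q \<bullet> (q - y))"
        using Fz unfolding weakly_tendsto_def by (intro tendsto_mult_left) auto
      then have "\<forall>\<^sub>F n in sequentially. ?e < (1 - t) * (F (z n) \<bullet> (q - y))"
        by (rule order_tendstoD) (use e in linarith)
      then have "\<forall>\<^sub>F n in sequentially. z n \<bullet> F (?y t) \<le> F (?y t) \<bullet> ?y t"
        using approx[OF y e]
      proof eventually_elim
        case (elim n)
        have "?y t - z n = (y - z n) + (1 - t) *\<^sub>R (q - y)" by (simp add: algebra_simps)
        then have "F (z n) \<bullet> (?y t - z n) = F (z n) \<bullet> (y - z n) + (1 - t) * (F (z n) \<bullet> (q - y))"
          by (simp only: inner_add_right inner_scaleR_right)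
        then have "0 \<le> F (z n) \<bullet> (?y t - z n)" using elim by linarith
        \<comment> \<open>Now \<open>F\<close> is evaluated at a fixed point, so the inequality is
          affine in \<open>z n\<close> and survives the weak limit. Before, two weakly convergent
          sequences were paired.\<close>
        then have "0 \<le> F (?y t) \<bullet> (?y t - z n)"
          using F(3) z(1) yt unfolding pseudo_monotone_on_def by blast
        then show ?case by (simp add: inner_diff_right inner_commute[of "z n"])
      qed
      moreover have "(\<lambda>n. z n \<bullet> F (?y t)) \<longlonglongrightarrow> q \<bullet> F (?y t)"
        using z(3) by (simp add: weakly_tendsto_def)
      ultimately have "q \<bullet> F (?y t) \<le> F (?y t) \<bullet> ?y t"
        by (intro tendsto_upperbound[where F = sequentially]) auto
      then have "0 \<le> t * (F (?y t) \<bullet> (y - q))"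
        by (simp add: inner_add_right inner_commute[of q])
      then show ?thesis using t by (simp add: zero_le_mult_iff)
    qed
    \<comment> \<open>Letting \<open>t\<close> tend to 0 moves \<open>?y t\<close> back to
      \<open>q\<close>, and continuity gives the very inequality that was assumed to fail.\<close>
    have "isCont F (?y 0)" using F(2) by (simp add: continuous_on_eq_continuous_at)
    then have "((\<lambda>t. F (?y t)) \<longlongrightarrow> F (?y 0)) (at_right 0)"
      by (rule isCont_tendsto_compose) (intro tendsto_intros)
    then have "((\<lambda>t. F (?y t) \<bullet> (y - q)) \<longlongrightarrow> F (?y 0) \<bullet> (y - q)) (at_right 0)"
      by (intro tendsto_inner tendsto_const)
    moreover have "\<forall>\<^sub>F t in at_right 0. 0 \<le> F (?y t) \<bullet> (y - q)"
      using eventually_at_right_real[OF zero_less_one] by eventually_elim (use minty in auto)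
    ultimately have "0 \<le> F (?y 0) \<bullet> (y - q)"
      by (intro tendsto_lowerbound[where F = "at_right 0"]) auto
    then show False using pos by (simp add: inner_diff_right)
  qed
  then show ?thesis using q by (simp add: VI_solutions_def)
qed

section \<open>Estimates for one forward-backward-forward step\<close>

text \<open>Shows that \<open>z\<close> almost solves the variational inequality when
  \<open>x - z\<close> is small. The projection inequality bounds the pairing with
  \<open>F x\<close> at cost \<open>1 / \<gamma>\<close>; replacing \<open>F x\<close> by
  \<open>F z\<close> costs \<open>L\<close>.\<close>

lemma VI_residual_lower_bound:
  fixes F :: "'a::real_inner \<Rightarrow> 'a"
  assumes L: "L-lipschitz_on UNIV F" and \<gamma>: "\<gamma> > 0"
    and proj: "(x - \<gamma> *\<^sub>R F x - z) \<bullet> (y - z) \<le> 0"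
  shows "- ((1 / \<gamma> + L) * norm (x - z) * norm (y - z)) \<le> F z \<bullet> (y - z)"
proof -
  have "(x - z) \<bullet> (y - z) \<le> \<gamma> * (F x \<bullet> (y - z))"
    using proj by (simp add: inner_diff_left)
  moreover have "- (norm (x - z) * norm (y - z)) \<le> (x - z) \<bullet> (y - z)"
    using Cauchy_Schwarz_ineq2[of "x - z" "y - z"] by linarith
  ultimately have "- (norm (x - z) * norm (y - z)) \<le> \<gamma> * (F x \<bullet> (y - z))" by linarith
  then have Fx: "- (1 / \<gamma> * norm (x - z) * norm (y - z)) \<le> F x \<bullet> (y - z)"
    using \<gamma> by (simp add: field_simps)
  have "norm (F x - F z) \<le> L * norm (x - z)"
    using lipschitz_onD[OF L, of x z] by (simp add: dist_norm)
  then have "(F x - F z) \<bullet> (y - z) \<le> L * norm (x - z) * norm (y - z)"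
    using order_trans[OF norm_cauchy_schwarz mult_right_mono[OF _ norm_ge_zero]] by blast
  with Fx show ?thesis by (simp add: inner_diff_left algebra_simps)
qed

lemma norm_convex_combination_square:
  fixes a b :: "'a::real_inner"
  assumes "0 \<le> t" "t \<le> 1"
  shows "(norm ((1 - t) *\<^sub>R a + t *\<^sub>R b))\<^sup>2 \<le> (1 - t) * (norm a)\<^sup>2 + t * (norm b)\<^sup>2"
proof -
  have "(1 - t) * (norm a)\<^sup>2 + t * (norm b)\<^sup>2 - (norm ((1 - t) *\<^sub>R a + t *\<^sub>R b))\<^sup>2
      = t * (1 - t) * (norm (a - b))\<^sup>2"
    unfolding power2_norm_eq_inner
    by (simp add: inner_simps inner_commute[of b a]) (simp add: algebra_simps)
  moreover have "0 \<le> t * (1 - t) * (norm (a - b))\<^sup>2" using assms by simp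
  ultimately show ?thesis by linarith
qed

text \<open>Pseudo-monotonicity between \<open>p\<close> and \<open>z\<close> gives the
  \<open>F z\<close> term its sign, and the projection inequality at \<open>p\<close> removes the
  \<open>F x\<close> term. The Lipschitz bound weighs the correction against the gained
  \<open>(norm (x - z))\<^sup>2\<close>. Only \<open>z\<close> has to lie in \<open>X\<close>, as
  the iterates \<open>x\<close> may leave it.\<close>

lemma forward_backward_forward_step:
  fixes F :: "'a::real_inner \<Rightarrow> 'a"
  assumes L: "L-lipschitz_on UNIV F" and \<gamma>: "\<gamma> > 0" and mono: "pseudo_monotone_on X F"
    and z: "z \<in> X" "\<And>y. y \<in> X \<Longrightarrow> (x - \<gamma> *\<^sub>R F x - z) \<bullet> (y - z) \<le> 0"
    and p: "p \<in> VI_solutions X F"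
  shows "(norm (z + \<gamma> *\<^sub>R (F x - F z) - p))\<^sup>2 \<le> (norm (x - p))\<^sup>2 - (1 - (\<gamma> * L)\<^sup>2) * (norm (x - z))\<^sup>2"
proof -
  have "0 \<le> F z \<bullet> (z - p)"
    using p mono z(1) by (auto simp: VI_solutions_def pseudo_monotone_on_def)
  then have Fz: "0 \<le> \<gamma> * (F z \<bullet> (z - p))" using \<gamma> by simp
  have "p \<in> X" using p by (simp add: VI_solutions_def)
  from z(2)[OF this] have proj: "\<gamma> * (F x \<bullet> (z - p)) \<le> (x - z) \<bullet> (z - p)"
    by (simp add: inner_simps algebra_simps)
  have "norm (F x - F z) \<le> L * norm (x - z)"
    using lipschitz_onD[OF L, of x z] by (simp add: dist_norm)
  then have "norm (\<gamma> *\<^sub>R (F x - F z)) \<le> \<gamma> * L * norm (x - z)"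
    using \<gamma> by (simp add: mult.assoc)
  then have lip: "(norm (\<gamma> *\<^sub>R (F x - F z)))\<^sup>2 \<le> (\<gamma> * L)\<^sup>2 * (norm (x - z))\<^sup>2"
    using power_mono[of _ _ 2] by (metis norm_ge_zero power_mult_distrib)
  have "(norm (z + \<gamma> *\<^sub>R (F x - F z) - p))\<^sup>2
      = (norm (z - p))\<^sup>2 + (norm (\<gamma> *\<^sub>R (F x - F z)))\<^sup>2
        + 2 * (\<gamma> * (F x \<bullet> (z - p))) - 2 * (\<gamma> * (F z \<bullet> (z - p)))"
  proof -
    have "z + \<gamma> *\<^sub>R (F x - F z) - p = (z - p) + \<gamma> *\<^sub>R (F x - F z)" by simp
    then show ?thesis
      by (simp only: power2_norm_eq_inner inner_add_left inner_add_right)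
        (simp add: inner_simps inner_commute algebra_simps)
  qed
  moreover have "(norm (z - p))\<^sup>2 = (norm (x - p))\<^sup>2 - (norm (x - z))\<^sup>2 - 2 * ((x - z) \<bullet> (z - p))"
    unfolding power2_norm_eq_inner by (simp add: inner_simps inner_commute)
  ultimately show ?thesis using Fz proj lip unfolding left_diff_distrib by linarith
qed

section \<open>Strong convergence to the solution of minimal norm\<close>

theorem theorem3p1:
  fixes X :: "'a::{real_inner, complete_space} set"
    and F :: "'a \<Rightarrow> 'a"
    and L \<gamma> \<alpha>0 :: real
    and \<alpha> \<beta> :: "nat \<Rightarrow> real"
    and x z r :: "nat \<Rightarrow> 'a"
  assumes "separable_space (euclidean :: 'a topology)"
    and "X \<noteq> {}" and "closed X" and "convex X"
    and "L > 0" and "L-lipschitz_on UNIV F"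
    and "seq_weak_weak_continuous_on_bounded F"
    and "pseudo_monotone_on X F"
    and "VI_solutions X F \<noteq> {}" and "closed (VI_solutions X F)" and "convex (VI_solutions X F)"
    and "\<gamma> \<in> {0<..<1/L}"
    and "\<And>k. \<alpha> k \<in> {0<..<1}" and "\<And>k. \<beta> k \<in> {0<..<1}"
    and "\<alpha>0 > 0" and "\<And>k. \<beta> k \<in> {\<alpha>0<..<1 - \<alpha> k}"
    and "\<alpha> \<longlonglongrightarrow> 0"
    and "filterlim (\<lambda>n. \<Sum>k=1..n. \<alpha> k) at_top sequentially"
    and "x 0 \<in> X"
    and "\<And>k. z k = metric_proj X (x k - \<gamma> *\<^sub>R F (x k))"
    and "\<And>k. r k = z k + \<gamma> *\<^sub>R (F (x k) - F (z k))"
    and "\<And>k. x (Suc k) = (1 - \<alpha> k - \<beta> k) *\<^sub>R x k + \<beta> k *\<^sub>R r k"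
  shows "\<exists>p\<in>VI_solutions X F. {q. is_arg_min norm (\<lambda>s. s \<in> VI_solutions X F) q} = {p} \<and> x \<longlonglongrightarrow> p"
proof -
  note sep = assms(1) and X = assms(2-4) and L = assms(5,6) and weak = assms(7)
    and mono = assms(8) and VI = assms(9-11) and div = assms(18)
    and z_def = assms(20) and r_def = assms(21) and x_Suc = assms(22)
  have \<gamma>: "0 < \<gamma>" "\<gamma> * L < 1" using assms(12) L(1) by (auto simp: field_simps)
  have \<alpha>: "0 < \<alpha> k" "\<alpha> k < 1" for k using assms(13)[of k] by auto
  have \<beta>: "\<alpha>0 < \<beta> k" "0 < \<beta> k" "\<alpha> k + \<beta> k < 1" "\<beta> k < 1" for k
    using assms(14,16)[of k] by auto
  have \<alpha>0: "0 < \<alpha>0" by (rule assms(15))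
  obtain p where p: "p \<in> VI_solutions X F" "\<And>s. s \<in> VI_solutions X F \<Longrightarrow> 0 \<le> p \<bullet> (s - p)"
      "{q. is_arg_min norm (\<lambda>s. s \<in> VI_solutions X F) q} = {p}"
    using min_norm_point[OF VI] by blast
  define \<theta> where "\<theta> = 1 - (\<gamma> * L)\<^sup>2"
  have \<theta>: "0 < \<theta>" using \<gamma> L(1) by (simp add: \<theta>_def power_less_one_iff)
  define d where "d k = norm (x k - z k)" for k
  have d0: "0 \<le> d k" for k by (simp add: d_def)
  have zX: "z k \<in> X" and z_proj: "\<And>y. y \<in> X \<Longrightarrow> (x k - \<gamma> *\<^sub>R F (x k) - z k) \<bullet> (y - z k) \<le> 0" for k
    using metric_proj_in_and_variational[OF X] by (auto simp: z_def)
  have fbf: "(norm (r k - p))\<^sup>2 \<le> (norm (x k - p))\<^sup>2 - \<theta> * (d k)\<^sup>2" for k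
    unfolding r_def \<theta>_def d_def
    by (rule forward_backward_forward_step[OF L(2) \<gamma>(1) mono zX z_proj p(1)])
  have rp: "norm (r k - p) \<le> norm (x k - p)" for k
  proof -
    have "0 \<le> \<theta> * (d k)\<^sup>2" using \<theta> by simp
    then have "(norm (r k - p))\<^sup>2 \<le> (norm (x k - p))\<^sup>2" using fbf[of k] by linarith
    then show ?thesis by (rule power2_le_imp_le) simp
  qed
  have xr: "norm (x k - r k) \<le> 2 * d k" for k
  proof -
    have "\<gamma> * norm (F (x k) - F (z k)) \<le> \<gamma> * (L * d k)"
      using lipschitz_onD[OF L(2), of "x k" "z k"] \<gamma>(1)
      by (intro mult_left_mono) (auto simp: dist_norm d_def)
    also have "\<dots> = \<gamma> * L * d k" by simp
    also have "\<dots> \<le> 1 * d k" using \<gamma> d0[of k] by (intro mult_right_mono) auto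
    finally have *: "norm (\<gamma> *\<^sub>R (F (x k) - F (z k))) \<le> d k" using \<gamma>(1) by simp
    have eq: "x k - r k = (x k - z k) - \<gamma> *\<^sub>R (F (x k) - F (z k))"
      by (simp add: r_def)
    show ?thesis
      using norm_triangle_ineq4[of "x k - z k" "\<gamma> *\<^sub>R (F (x k) - F (z k))"] *
      unfolding eq d_def by linarith
  qed
  \<comment> \<open>The next iterate is a convex combination of \<open>x k\<close>,
    \<open>r k\<close> and 0, with weight \<open>\<alpha> k\<close> on 0. A ball around
    \<open>p\<close> containing \<open>x 0\<close> and 0 is therefore never left.\<close>
  define R where "R = max (norm (x 0 - p)) (norm p)"
  have R: "0 \<le> R" "norm p \<le> R" by (auto simp: R_def le_max_iff_disj)
  have xR: "norm (x k - p) \<le> R" for k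
  proof (induction k)
    case 0
    then show ?case by (simp add: R_def)
  next
    case (Suc k)
    have "x (Suc k) - p = (1 - \<alpha> k - \<beta> k) *\<^sub>R (x k - p) + \<beta> k *\<^sub>R (r k - p) - \<alpha> k *\<^sub>R p"
      by (simp add: x_Suc algebra_simps)
    then have "norm (x (Suc k) - p)
        \<le> norm ((1 - \<alpha> k - \<beta> k) *\<^sub>R (x k - p)) + norm (\<beta> k *\<^sub>R (r k - p)) + norm (\<alpha> k *\<^sub>R p)"
      by (simp only:) (intro order_trans[OF norm_triangle_ineq4] add_right_mono norm_triangle_ineq)
    also have "\<dots> = (1 - \<alpha> k - \<beta> k) * norm (x k - p) + \<beta> k * norm (r k - p) + \<alpha> k * norm p"
      using \<alpha>(1)[of k] \<beta>[of k] by simp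
    also have "\<dots> \<le> (1 - \<alpha> k - \<beta> k) * R + \<beta> k * R + \<alpha> k * R"
      using \<alpha>(1)[of k] \<beta>[of k] R rp[of k] Suc.IH by (intro add_mono mult_left_mono) auto
    finally show ?case by (simp add: algebra_simps)
  qed
  have xM: "norm (x k) \<le> 2 * R" for k
    using norm_triangle_ineq[of "x k - p" p] xR[of k] R(2) by simp
  define a where "a k = (norm (x k - p))\<^sup>2" for k
  define b where "b k = - 2 * ((\<beta> k *\<^sub>R (x k - r k) + p) \<bullet> (x (Suc k) - p))" for k
  \<comment> \<open>One factor \<open>\<alpha>0\<close> comes from
    \<open>\<beta> k > \<alpha>0\<close>, the other from
    \<open>1 - \<alpha> k > \<beta> k > \<alpha>0\<close>.\<close>
  define c where "c = \<alpha>0\<^sup>2 * \<theta>"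
  have c: "0 < c" using \<alpha>0 \<theta> by (simp add: c_def)
  have key: "a (Suc k) \<le> (1 - \<alpha> k) * a k + \<alpha> k * (b k - c * (d k)\<^sup>2 / \<alpha> k)" for k
  proof -
    \<comment> \<open>\<open>w\<close> is the relaxed step without the pull to 0, measured from
      \<open>p\<close>, and \<open>v\<close> is the gap between
      \<open>(1 - \<alpha> k) *\<^sub>R w\<close> and \<open>x (Suc k) - p\<close>. Expanding the
      square produces \<open>b k\<close>; the nonnegative \<open>(norm v)\<^sup>2\<close> is
      dropped.\<close>
    define w where "w = (1 - \<beta> k) *\<^sub>R (x k - p) + \<beta> k *\<^sub>R (r k - p)"
    define v where "v = \<alpha> k *\<^sub>R (\<beta> k *\<^sub>R (x k - r k) + p)"
    have "(norm w)\<^sup>2 \<le> (1 - \<beta> k) * a k + \<beta> k * (norm (r k - p))\<^sup>2"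
      unfolding w_def a_def using \<beta>[of k] by (intro norm_convex_combination_square) auto
    also have "\<dots> \<le> (1 - \<beta> k) * a k + \<beta> k * (a k - \<theta> * (d k)\<^sup>2)"
      using \<beta>[of k] fbf[of k] by (intro add_left_mono mult_left_mono) (auto simp: a_def)
    also have "\<dots> = a k - \<beta> k * (\<theta> * (d k)\<^sup>2)" by (simp add: algebra_simps)
    also have "\<dots> \<le> a k - \<alpha>0 * (\<theta> * (d k)\<^sup>2)"
      using \<beta>(1)[of k] \<theta> by (intro diff_left_mono mult_right_mono) auto
    finally have w: "(norm w)\<^sup>2 \<le> a k - \<alpha>0 * (\<theta> * (d k)\<^sup>2)" .
    have "\<alpha>0 * (\<alpha>0 * (\<theta> * (d k)\<^sup>2)) \<le> (1 - \<alpha> k) * (\<alpha>0 * (\<theta> * (d k)\<^sup>2))"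
      using \<beta>[of k] \<alpha>0 \<theta> by (intro mult_right_mono) auto
    then have cd: "c * (d k)\<^sup>2 \<le> (1 - \<alpha> k) * (\<alpha>0 * (\<theta> * (d k)\<^sup>2))"
      by (simp add: c_def power2_eq_square mult.assoc)
    have eq: "(1 - \<alpha> k) *\<^sub>R w = (x (Suc k) - p) + v"
      unfolding w_def v_def x_Suc by (simp add: algebra_simps)
    have "(norm ((1 - \<alpha> k) *\<^sub>R w))\<^sup>2 = a (Suc k) + 2 * (v \<bullet> (x (Suc k) - p)) + (norm v)\<^sup>2"
      unfolding eq a_def power2_norm_eq_inner
      by (simp only: inner_add_left inner_add_right inner_commute[of v "x (Suc k) - p"])
    moreover have "0 \<le> (norm v)\<^sup>2" by simp
    moreover have "2 * (v \<bullet> (x (Suc k) - p)) = - (\<alpha> k * b k)"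
      by (simp add: v_def b_def)
    ultimately have "a (Suc k) \<le> (norm ((1 - \<alpha> k) *\<^sub>R w))\<^sup>2 + \<alpha> k * b k" by linarith
    also have "(norm ((1 - \<alpha> k) *\<^sub>R w))\<^sup>2 = (1 - \<alpha> k) * ((1 - \<alpha> k) * (norm w)\<^sup>2)"
      using \<alpha>[of k] by (simp add: power2_eq_square)
    also have "\<dots> \<le> (1 - \<alpha> k) * (1 * (norm w)\<^sup>2)"
      using \<alpha>[of k] by (intro mult_left_mono mult_right_mono) auto
    also have "\<dots> \<le> (1 - \<alpha> k) * (a k - \<alpha>0 * (\<theta> * (d k)\<^sup>2))"
      using \<alpha>[of k] w by (intro mult_left_mono) auto
    finally have "a (Suc k) \<le> (1 - \<alpha> k) * a k - c * (d k)\<^sup>2 + \<alpha> k * b k"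
      using cd by (simp add: right_diff_distrib)
    then show ?thesis using \<alpha>(1)[of k] by (simp add: right_diff_distrib)
  qed
  \<comment> \<open>Separates a part controlled by \<open>d k\<close> from the pairing with
    \<open>p\<close>, whose weak limit can be taken.\<close>
  have b_le: "b k \<le> 4 * R * d k - 2 * (p \<bullet> (x (Suc k) - p))" for k
  proof -
    have "\<bar>(x k - r k) \<bullet> (x (Suc k) - p)\<bar> \<le> 2 * d k * R"
      using Cauchy_Schwarz_ineq2 mult_mono[OF xr[of k] xR[of "Suc k"]] d0[of k]
      by (meson mult_nonneg_nonneg norm_ge_zero order_trans zero_le_numeral)
    then have "\<beta> k * \<bar>(x k - r k) \<bullet> (x (Suc k) - p)\<bar> \<le> 1 * (2 * d k * R)"
      using \<beta>[of k] by (intro mult_mono) auto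
    also have "\<dots> = 2 * (R * d k)" by simp
    finally have "\<beta> k * \<bar>(x k - r k) \<bullet> (x (Suc k) - p)\<bar> \<le> 2 * (R * d k)" .
    moreover have "\<beta> k * - ((x k - r k) \<bullet> (x (Suc k) - p))
        \<le> \<beta> k * \<bar>(x k - r k) \<bullet> (x (Suc k) - p)\<bar>"
      using \<beta>(2)[of k] by (intro mult_left_mono abs_ge_minus_self) simp
    ultimately show ?thesis by (simp add: b_def inner_add_left)
  qed
  define E where "E = sqrt (R\<^sup>2 / \<theta>)"
  have dE: "d k \<le> E" for k
  proof -
    have "\<theta> * (d k)\<^sup>2 \<le> (norm (x k - p))\<^sup>2"
      using fbf[of k] zero_le_power2[of "norm (r k - p)"] by linarith
    also have "\<dots> \<le> R\<^sup>2" using xR[of k] by (simp add: power_mono)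
    finally have "(d k)\<^sup>2 \<le> R\<^sup>2 / \<theta>" using \<theta> by (simp add: field_simps)
    then show ?thesis unfolding E_def by (rule real_le_rsqrt)
  qed
  define K where "K = 4 * R * E + 2 * (R * R)"
  have bK: "b k \<le> K" for k
  proof -
    have "4 * R * d k \<le> 4 * R * E" using dE[of k] R by (intro mult_left_mono) auto
    moreover have "\<bar>p \<bullet> (x (Suc k) - p)\<bar> \<le> R * R"
      using Cauchy_Schwarz_ineq2 mult_mono[OF R(2) xR[of "Suc k"] R(1) norm_ge_zero]
      by (rule order_trans)
    ultimately show ?thesis using b_le[of k] unfolding K_def by linarith
  qed
  have "\<forall>\<^sub>F k in sequentially. b k - c * (d k)\<^sup>2 / \<alpha> k \<le> e" if e: "e > 0" for e
  proof (rule ccontr)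
    assume "\<not> ?thesis"
    then obtain s where s: "strict_mono (s :: nat \<Rightarrow> nat)"
      and "\<And>n. \<not> b (s n) - c * (d (s n))\<^sup>2 / \<alpha> (s n) \<le> e"
      using not_eventually_sequentiallyD by blast
    then have sB: "e < b (s n) - c * (d (s n))\<^sup>2 / \<alpha> (s n)" for n by (simp add: not_le)
    obtain j q where j: "strict_mono j" and "weakly_tendsto ((x \<circ> s) \<circ> j) q"
      using bounded_imp_weakly_convergent_subseq[OF sep, of "x \<circ> s" "2 * R"] xM by auto
    define \<sigma> where "\<sigma> = s \<circ> j"
    have xq: "weakly_tendsto (\<lambda>n. x (\<sigma> n)) q"
      using \<open>weakly_tendsto ((x \<circ> s) \<circ> j) q\<close> by (simp add: \<sigma>_def o_def)
    have \<sigma>: "strict_mono \<sigma>" unfolding \<sigma>_def by (rule strict_mono_o[OF s j])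
    have B: "e < b (\<sigma> n) - c * (d (\<sigma> n))\<^sup>2 / \<alpha> (\<sigma> n)" for n using sB by (simp add: \<sigma>_def)
    have \<alpha>\<sigma>: "(\<lambda>n. \<alpha> (\<sigma> n)) \<longlonglongrightarrow> 0"
      using LIMSEQ_subseq_LIMSEQ[OF assms(17) \<sigma>] by (simp add: o_def)
    \<comment> \<open>Since the bracket stays above \<open>e > 0\<close> and \<open>b\<close> is
      bounded by \<open>K\<close>, the penalty is at most \<open>K\<close>. So the squared residual
      is of order \<open>\<alpha>\<close> and vanishes along the subsequence.\<close>
    have d2: "(d (\<sigma> n))\<^sup>2 \<le> \<alpha> (\<sigma> n) * (K / c)" for n
    proof -
      have "c * (d (\<sigma> n))\<^sup>2 / \<alpha> (\<sigma> n) \<le> K" using B[of n] bK[of "\<sigma> n"] e by linarith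
      then show ?thesis using c \<alpha>(1)[of "\<sigma> n"] by (simp add: field_simps)
    qed
    have "(\<lambda>n. (d (\<sigma> n))\<^sup>2) \<longlonglongrightarrow> 0"
    proof (rule tendsto_sandwich[OF _ _ tendsto_const])
      show "(\<lambda>n. \<alpha> (\<sigma> n) * (K / c)) \<longlonglongrightarrow> 0" using tendsto_mult_left_zero[OF \<alpha>\<sigma>] .
    qed (use d2 in auto)
    from tendsto_real_sqrt[OF this] have d\<sigma>: "(\<lambda>n. d (\<sigma> n)) \<longlonglongrightarrow> 0" using d0 by simp
    have "(\<lambda>n. z (\<sigma> n) - x (\<sigma> n)) \<longlonglongrightarrow> 0"
      using d\<sigma> by (intro tendsto_norm_zero_cancel[of "\<lambda>n. z (\<sigma> n) - x (\<sigma> n)"])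
        (simp add: d_def norm_minus_commute)
    with xq have zq: "weakly_tendsto (\<lambda>n. z (\<sigma> n)) q" by (rule weakly_tendsto_add_null)
    have zb: "norm (z k) \<le> 2 * R + E" for k
      using norm_triangle_ineq4[of "x k" "x k - z k"] xM[of k] dE[of k] by (simp add: d_def)
    have q: "q \<in> VI_solutions X F"
    proof (rule weak_limit_in_VI_solutions[OF X(2,3) weak lipschitz_on_continuous_on[OF L(2)] mono zX _ zq])
      show "bounded (range (\<lambda>n. z (\<sigma> n)))" using zb by (auto simp: bounded_iff)
      fix y' and e' :: real assume y': "y' \<in> X" and e': "e' > 0"
      \<comment> \<open>The last factor bounds \<open>norm (y' - z k)\<close> uniformly in
        \<open>k\<close>, so the residual bound becomes a constant times \<open>d\<close>.\<close>
      let ?G = "(1 / \<gamma> + L) * (norm y' + (2 * R + E))"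
      have "(\<lambda>n. ?G * d (\<sigma> n)) \<longlonglongrightarrow> ?G * 0" by (intro tendsto_mult_left d\<sigma>)
      then have "\<forall>\<^sub>F n in sequentially. ?G * d (\<sigma> n) < e'"
        by (rule order_tendstoD) (use e' in simp)
      then show "\<forall>\<^sub>F n in sequentially. - e' \<le> F (z (\<sigma> n)) \<bullet> (y' - z (\<sigma> n))"
      proof eventually_elim
        case (elim n)
        have "(1 / \<gamma> + L) * d (\<sigma> n) * norm (y' - z (\<sigma> n))
            \<le> (1 / \<gamma> + L) * d (\<sigma> n) * (norm y' + (2 * R + E))"
          using norm_triangle_ineq4[of y' "z (\<sigma> n)"] zb[of "\<sigma> n"] \<gamma> L(1) d0
          by (intro mult_left_mono) auto
        also have "\<dots> = ?G * d (\<sigma> n)" by simp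
        finally show ?case
          using VI_residual_lower_bound[OF L(2) \<gamma>(1) z_proj[OF y', of "\<sigma> n"]] elim
          by (simp add: d_def)
      qed
    qed
    \<comment> \<open>\<open>b_le\<close> pairs \<open>p\<close> with the next iterate, so the weak
      limit \<open>q\<close> has to be transferred to the shifted subsequence.\<close>
    have "(\<lambda>n. x (Suc (\<sigma> n)) - x (\<sigma> n)) \<longlonglongrightarrow> 0"
    proof (rule Lim_null_comparison)
      show "(\<lambda>n. \<alpha> (\<sigma> n) * (2 * R) + 2 * d (\<sigma> n)) \<longlonglongrightarrow> 0"
        using tendsto_add[OF tendsto_mult_left_zero[OF \<alpha>\<sigma>] tendsto_mult_right_zero[OF d\<sigma>]] by simp
      have "norm (x (Suc k) - x k) \<le> \<alpha> k * (2 * R) + 2 * d k" for k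
      proof -
        have "x (Suc k) - x k = - (\<alpha> k *\<^sub>R x k + \<beta> k *\<^sub>R (x k - r k))"
          by (simp add: x_Suc algebra_simps)
        then have "norm (x (Suc k) - x k) \<le> norm (\<alpha> k *\<^sub>R x k) + norm (\<beta> k *\<^sub>R (x k - r k))"
          by (simp only: norm_minus_cancel norm_triangle_ineq)
        also have "\<dots> = \<alpha> k * norm (x k) + \<beta> k * norm (x k - r k)"
          using \<alpha>(1)[of k] \<beta>(2)[of k] by simp
        also have "\<dots> \<le> \<alpha> k * (2 * R) + 1 * (2 * d k)"
          using \<alpha>(1)[of k] \<beta>[of k] xM[of k] xr[of k] by (intro add_mono mult_mono) auto
        finally show ?thesis by simp
      qed
      then show "\<forall>\<^sub>F n in sequentially. norm (x (Suc (\<sigma> n)) - x (\<sigma> n)) \<le> \<alpha> (\<sigma> n) * (2 * R) + 2 * d (\<sigma> n)"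
        by simp
    qed
    with xq have "weakly_tendsto (\<lambda>n. x (Suc (\<sigma> n))) q" by (rule weakly_tendsto_add_null)
    then have "(\<lambda>n. x (Suc (\<sigma> n)) \<bullet> p) \<longlonglongrightarrow> q \<bullet> p" by (simp add: weakly_tendsto_def)
    from tendsto_diff[OF this tendsto_const[of "p \<bullet> p"]]
    have "(\<lambda>n. p \<bullet> (x (Suc (\<sigma> n)) - p)) \<longlonglongrightarrow> p \<bullet> (q - p)"
      by (simp add: inner_diff_right inner_commute)
    then have "(\<lambda>n. 4 * R * d (\<sigma> n) - 2 * (p \<bullet> (x (Suc (\<sigma> n)) - p))) \<longlonglongrightarrow> 4 * R * 0 - 2 * (p \<bullet> (q - p))"
      by (intro tendsto_diff tendsto_mult_left d\<sigma>)
    moreover have "e \<le> 4 * R * d (\<sigma> n) - 2 * (p \<bullet> (x (Suc (\<sigma> n)) - p))" for n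
    proof -
      have "0 \<le> c * (d (\<sigma> n))\<^sup>2 / \<alpha> (\<sigma> n)" using c \<alpha>(1)[of "\<sigma> n"] by simp
      then show ?thesis using B[of n] b_le[of "\<sigma> n"] by linarith
    qed
    \<comment> \<open>In the limit \<open>e\<close> is at most
      \<open>- 2 * (p \<bullet> (q - p))\<close>, which is nonpositive because \<open>q\<close> is a
      solution and \<open>p\<close> the one of minimal norm.\<close>
    ultimately have "e \<le> 4 * R * 0 - 2 * (p \<bullet> (q - p))" by (intro LIMSEQ_le_const) auto
    then show False using p(2)[OF q] e by simp
  qed
  then have "a \<longlonglongrightarrow> 0"
    by (intro recursive_inequality_tendsto_zero[OF _ _ div _ key]) (auto simp: a_def less_imp_le[OF \<alpha>(1)] less_imp_le[OF \<alpha>(2)])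
  from tendsto_real_sqrt[OF this] have "(\<lambda>k. norm (x k - p)) \<longlonglongrightarrow> 0" by (simp add: a_def)
  then have "x \<longlonglongrightarrow> p" using LIM_zero_cancel tendsto_norm_zero_iff by blast
  with p(1,3) show ?thesis by blast
qed

end
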